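(* Let $p>0$ and $q\ge1$ be integers. Then the equation $$s_q\star[b_q\star b_q]_{\downarrow q}=\delta_0$$ is uniquely solvable for $s_q\in\ell^2(\mathbb{Z})$, and the coefficients $s_q(k)$ decay exponentially as $|k|\to\infty$.
   Context: The centred B-splines are $\beta^0(t)=1$ for $t\in[-\tfrac12,\tfrac12)$ and $0$ otherwise, and $\beta^p=\beta^{p-1}\star\beta^0$ for $p\ge1$ (convolution on $\mathbb{R}$). The sampled B-spline of degree $p$ with oversampling factor $q$ is the sequence $b_q(k)=\beta^p(k/q)$, $k\in\mathbb{Z}$. For sequences on $\mathbb{Z}$, $(a\star b)(k)=\sum_{l\in\mathbb{Z}}a(k-l)b(l)$ is discrete convolution, $[a]_{\downarrow q}(k)=a(qk)$ is downsampling, and $\delta_0(k)=1$ if $k=0$ and $0$ otherwise. Exponential decay means $|s_q(k)|\le Cr^{|k|}$ for some $C>0$, $0<r<1$. *)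

theory Defs
  imports "HOL-Analysis.Analysis"
begin

definition convolution_real :: "(real \<Rightarrow> real) \<Rightarrow> (real \<Rightarrow> real) \<Rightarrow> real \<Rightarrow> real" where
  "convolution_real f g t = (LINT u|lborel. f (t - u) * g u)"

primrec bspline :: "nat \<Rightarrow> real \<Rightarrow> real" where
  "bspline 0 = indicator {-1/2..<1/2}"
| "bspline (Suc p) = convolution_real (bspline p) (indicator {-1/2..<1/2})"

text \<open>Sequences take values in \<^typ>\<open>'a\<close>, to be read as \<^typ>\<open>real\<close> or \<^typ>\<open>complex\<close>;
  the real samples of the B-spline are embedded by \<^const>\<open>of_real\<close>.\<close>

definition sampled_bspline :: "nat \<Rightarrow> nat \<Rightarrow> int \<Rightarrow> 'a::{real_normed_field,banach}" where
  "sampled_bspline p q k = of_real (bspline p (of_int k / of_nat q))"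

text \<open>A series that is not unconditionally summable has the value \<open>0\<close> under \<^const>\<open>infsum\<close>.
  This does not matter for the convolutions used here, whose right factor has finite support.\<close>

definition convolution_int ::
    "(int \<Rightarrow> 'a::{real_normed_field,banach}) \<Rightarrow> (int \<Rightarrow> 'a) \<Rightarrow> int \<Rightarrow> 'a" (infixl \<open>\<star>\<close> 70) where
  "(a \<star> b) k = (\<Sum>\<^sub>\<infinity>l\<in>UNIV. a (k - l) * b l)"

definition downsample :: "nat \<Rightarrow> (int \<Rightarrow> 'a) \<Rightarrow> int \<Rightarrow> 'a" where
  "downsample q a k = a (int q * k)"

definition delta0 :: "int \<Rightarrow> 'a::zero_neq_one" where
  "delta0 k = (if k = 0 then 1 else 0)"

definition ell2 :: "(int \<Rightarrow> 'a::real_normed_vector) set" where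
  "ell2 = {s. (\<lambda>k. (norm (s k))\<^sup>2) summable_on UNIV}"

definition exponential_decay :: "(int \<Rightarrow> 'a::real_normed_vector) \<Rightarrow> bool" where
  "exponential_decay s \<longleftrightarrow>
     (\<exists>C>0. \<exists>r. 0 < r \<and> r < 1 \<and> (\<forall>k. norm (s k) \<le> C * r ^ nat \<bar>k\<bar>))"

end

theory Submission
  imports Defs
begin

text \<open>
  The symbol of \<open>[b\<^sub>q \<star> b\<^sub>q]\<down>q\<close> at \<open>\<theta>\<close> is the sum of
  \<open>\<bar>f (r / q)\<bar>\<^sup>2\<close> over \<open>0 \<le> r < q\<close>, where \<open>f x = (\<Sum>k. \<beta>\<^sup>p (x - k) e\<^sup>i\<^sup>k\<^sup>\<theta>)\<close> is the exponential
  Euler spline. It suffices that \<open>f 0 \<noteq> 0\<close>: then the symbol is positive, and the Fourier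
  coefficients of its reciprocal form an exponentially decaying convolution inverse, which is
  unique in \<open>\<ell>\<^sup>2\<close> because convolution is associative for the sequences involved.
  Passing from \<open>p\<close> to \<open>p + 1\<close> averages \<open>f\<close> over a unit interval. For \<open>0 \<le> \<theta> \<le> \<pi>\<close> this
  preserves the property that \<open>f\<close> maps \<open>[0, 1/2]\<close> to the first quadrant and \<open>f 0 > 0\<close>.
\<close>

subsection \<open>B-splines\<close>

text \<open>The later inductions start from this hat function: degree 0 is neither continuous nor
  even, because its box is half-open.\<close>

lemma bspline_1: "bspline (Suc 0) t = max 0 (1 - \<bar>t\<bar>)"
proof -
  let ?I = "{-1/2..<1/2} :: real set"
  let ?J = "{t - 1/2<..t + 1/2} \<inter> ?I"
  have "bspline (Suc 0) t = (LINT u|lborel. indicator ?J u)"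
    unfolding bspline.simps convolution_real_def
    by (intro Bochner_Integration.integral_cong refl) (auto simp: indicator_def)
  also have "\<dots> = measure lborel ?J" by simp
  also have "\<dots> = max 0 (1 - \<bar>t\<bar>)"
  proof (cases "t < 0")
    case True
    then have J: "?J = {-1/2..t + 1/2}" by auto
    show ?thesis unfolding J using True by (cases "t + 1/2 < -1/2") auto
  next
    case False
    then have J: "?J = {t - 1/2<..<1/2}" by auto
    show ?thesis unfolding J using False by (cases "t - 1/2 > 1/2") auto
  qed
  finally show ?thesis .
qed

text \<open>The half-open and the closed box differ by the null set {1/2}, and reflecting
  \<open>u\<close> turns \<open>f (t - u)\<close> into \<open>f (t + u)\<close>.\<close>

lemma convolution_real_box:
  fixes f :: "real \<Rightarrow> real"
  assumes f: "continuous_on UNIV f"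
  shows "convolution_real f (indicator {-1/2..<1/2}) t = integral {-1/2..1/2} (\<lambda>u. f (t + u))"
proof -
  have c: "continuous_on A (\<lambda>u. f (t - u))" for A
    by (intro continuous_intros continuous_on_compose2[OF f]) auto
  have "convolution_real f (indicator {-1/2..<1/2}) t
      = (LINT u|lborel. indicator {-1/2..1/2} u *\<^sub>R f (t - u))"
    unfolding convolution_real_def
  proof (rule integral_cong_AE)
    have [measurable]: "(\<lambda>u. f (t - u)) \<in> borel_measurable borel"
      using borel_measurable_continuous_onI[OF c] .
    show "(\<lambda>u. f (t - u) * indicator {- 1 / 2..<1 / 2} u) \<in> borel_measurable lborel" by measurable
    show "(\<lambda>u. indicator {- 1 / 2..1 / 2} u *\<^sub>R f (t - u)) \<in> borel_measurable lborel" by measurable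
    show "AE u in lborel. f (t - u) * indicator {- 1 / 2..<1 / 2} u = indicator {- 1 / 2..1 / 2} u *\<^sub>R f (t - u)"
      using AE_lborel_singleton[of "1/2 :: real"] by eventually_elim (auto simp: indicator_def)
  qed
  also have "\<dots> = integral {-1/2..1/2} (\<lambda>u. f (t - u))"
    unfolding set_lebesgue_integral_def[symmetric]
    by (rule set_borel_integral_eq_integral, unfold set_integrable_def)
       (rule borel_integrable_compact[OF compact_Icc c])
  also have "\<dots> = integral {-1/2..1/2} (\<lambda>u. f (t + u))"
    using Henstock_Kurzweil_Integration.integral_reflect_real[of "1/2" "-1/2" "\<lambda>u. f (t + u)"] by simp
  finally show ?thesis .
qed

lemma continuous_on_box_average:
  fixes f :: "real \<Rightarrow> real"
  assumes f: "continuous_on UNIV f"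
  shows "continuous_on UNIV (\<lambda>x. integral {-1/2..1/2} (\<lambda>u. f (x + u)))"
proof -
  have "continuous_on (UNIV \<times> cbox (-1/2) (1/2)) (\<lambda>(x, u). f (x + u))"
    unfolding case_prod_beta by (intro continuous_intros continuous_on_compose2[OF f]) auto
  from integral_continuous_on_param[OF this] show ?thesis by simp
qed

lemma continuous_bspline: "0 < p \<Longrightarrow> continuous_on UNIV (bspline p)"
proof (induction p)
  case (Suc p)
  show ?case
  proof (cases "p = 0")
    case True
    then have "bspline (Suc p) = (\<lambda>t. max 0 (1 - \<bar>t\<bar>))" using bspline_1 by auto
    then show ?thesis by (simp add: continuous_intros)
  next
    case False
    with Suc have "continuous_on UNIV (bspline p)" by simp
    from continuous_on_box_average[OF this] show ?thesis
      unfolding bspline.simps convolution_real_box[OF \<open>continuous_on UNIV (bspline p)\<close>, abs_def] .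
  qed
qed simp

lemma bspline_Suc:
  assumes "0 < p"
  shows "bspline (Suc p) t = integral {-1/2..1/2} (\<lambda>u. bspline p (t + u))"
  using convolution_real_box[OF continuous_bspline[OF assms]] by simp

lemma bspline_minus: "0 < p \<Longrightarrow> bspline p (- t) = bspline p t"
proof (induction p arbitrary: t)
  case (Suc p)
  show ?case
  proof (cases "p = 0")
    case True
    then show ?thesis using bspline_1 by simp
  next
    case False
    then have p: "0 < p" by simp
    have "integral {-1/2..1/2} (\<lambda>u. bspline p (- t + u))
        = integral {-1/2..1/2} (\<lambda>u. bspline p (- t + (- u)))"
      using Henstock_Kurzweil_Integration.integral_reflect_real[of "1/2" "-1/2" "\<lambda>u. bspline p (- t + u)"] by simp
    also have "\<dots> = integral {-1/2..1/2} (\<lambda>u. bspline p (t + u))"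
      using Suc.IH[OF p] by (metis minus_add_distrib)
    finally show ?thesis using bspline_Suc[OF p] by simp
  qed
qed simp

text \<open>Each averaging widens the support by 1/2 on either side. The bound \<open>p + 1\<close>
  is cruder than the sharp (p + 1)/2, but it is enough to make every sum below finite.\<close>

lemma bspline_eq_0:
  assumes "0 < p" "real p + 1 \<le> \<bar>t\<bar>"
  shows "bspline p t = 0"
  using assms
proof (induction p arbitrary: t)
  case (Suc p)
  show ?case
  proof (cases "p = 0")
    case True
    then show ?thesis using bspline_1 Suc by simp
  next
    case False
    then have p: "0 < p" by simp
    have "integral {-1/2..1/2} (\<lambda>u. bspline p (t + u)) = integral {-1/2..1/2 :: real} (\<lambda>u. 0 :: real)"
      using Suc p by (intro integral_cong Suc.IH) auto
    then show ?thesis using bspline_Suc[OF p] by simp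
  qed
qed simp

subsection \<open>Exponential Euler splines\<close>

text \<open>The degree-raising operator of \<open>bspline_Suc\<close>, that is, convolution with the
  box.\<close>

definition box_average :: "(real \<Rightarrow> real) \<Rightarrow> real \<Rightarrow> real" where
  "box_average f x = integral {-1/2..1/2} (\<lambda>u. f (x + u))"

text \<open>For an antiderivative \<open>F\<close> of \<open>f\<close>, the average at
  \<open>x\<close> is \<open>F (x + 1/2) - F (x - 1/2)\<close>.\<close>

lemma DERIV_box_average:
  assumes f: "continuous_on UNIV f"
  shows "(box_average f has_real_derivative f (x + 1/2) - f (x - 1/2)) (at x)"
proof -
  obtain F where F: "\<And>y. (F has_vector_derivative f y) (at y)"
    using einterval_antiderivative[of "-\<infinity>" "\<infinity>" f] f
    by (auto simp: continuous_on_eq_continuous_at)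
  have [derivative_intros]: "((\<lambda>y. F (g y)) has_real_derivative f (g y) * g') (at y within A)"
    if "(g has_real_derivative g') (at y within A)" for g g' y A
    using F that by (metis DERIV_chain2 has_real_derivative_iff_has_vector_derivative)
  have "box_average f = (\<lambda>x. F (x + 1/2) - F (x - 1/2))"
  proof
    fix x
    have "((\<lambda>u. f (x + u)) has_integral F (x + 1/2) - F (x + - 1/2)) {-1/2..1/2}"
      by (rule fundamental_theorem_of_calculus)
        (auto simp: has_real_derivative_iff_has_vector_derivative[symmetric] intro!: derivative_eq_intros)
    then show "box_average f x = F (x + 1/2) - F (x - 1/2)"
      unfolding box_average_def by (simp add: integral_unique)
  qed
  then show ?thesis by (auto intro!: derivative_eq_intros)
qed

text \<open>The functions \<open>c\<close> and \<open>s\<close> are the real and imaginary parts of \<open>f\<close> with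
  \<open>f (- x) = cnj (f x)\<close> and \<open>f (x + 1) = e\<^sup>i\<^sup>\<theta> f x\<close> for \<open>\<theta> = 2 * \<phi>\<close>.\<close>

definition euler_pair :: "real \<Rightarrow> (real \<Rightarrow> real) \<Rightarrow> (real \<Rightarrow> real) \<Rightarrow> bool" where
  "euler_pair \<phi> c s \<longleftrightarrow> continuous_on UNIV c \<and> continuous_on UNIV s \<and>
    (\<forall>x. c (- x) = c x) \<and> (\<forall>x. s (- x) = - s x) \<and>
    (\<forall>x. c (x + 1) = cos (2 * \<phi>) * c x - sin (2 * \<phi>) * s x) \<and>
    (\<forall>x. s (x + 1) = sin (2 * \<phi>) * c x + cos (2 * \<phi>) * s x) \<and>
    (\<forall>x\<in>{0..1/2}. 0 \<le> c x \<and> 0 \<le> s x) \<and> 0 < c 0"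

text \<open>Continuity, parity and the shift rules pass through the integral. The signs come from
  monotonicity: \<open>?S\<close> increases from 0 at 0, and \<open>V\<close> decreases to 0 at 1/2,
  so \<open>sin \<phi> * ?C\<close> is at least \<open>cos \<phi> * ?S\<close> on [0, 1/2], which is
  nonnegative.\<close>

lemma euler_pair_box_average:
  assumes \<phi>: "0 \<le> \<phi>" "\<phi> \<le> pi / 2" and cs: "euler_pair \<phi> c s"
  shows "euler_pair \<phi> (box_average c) (box_average s)"
proof -
  note cs' = cs[unfolded euler_pair_def]
  have cont: "continuous_on UNIV c" "continuous_on UNIV s"
    and c_even: "\<And>x. c (- x) = c x" and s_odd: "\<And>x. s (- x) = - s x"
    and c_shift: "\<And>x. c (x + 1) = cos (2 * \<phi>) * c x - sin (2 * \<phi>) * s x"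
    and s_shift: "\<And>x. s (x + 1) = sin (2 * \<phi>) * c x + cos (2 * \<phi>) * s x"
    and c_ge: "\<And>x. 0 \<le> x \<Longrightarrow> x \<le> 1/2 \<Longrightarrow> 0 \<le> c x" and s_ge: "\<And>x. 0 \<le> x \<Longrightarrow> x \<le> 1/2 \<Longrightarrow> 0 \<le> s x"
    and c0: "0 < c 0"
    using cs' by auto
  let ?C = "box_average c" and ?S = "box_average s"
  have ci: "continuous_on A (\<lambda>u. c (x + u))" "continuous_on A (\<lambda>u. s (x + u))" for A x
    by (intro continuous_intros continuous_on_compose2[OF cont(1)] continuous_on_compose2[OF cont(2)]; simp)+
  have int: "(\<lambda>u. c (x + u)) integrable_on {-1/2..1/2}" "(\<lambda>u. s (x + u)) integrable_on {-1/2..1/2}" for x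
    by (intro integrable_continuous_interval ci)+
  have contC: "continuous_on UNIV ?C" "continuous_on UNIV ?S"
    using continuous_on_box_average[OF cont(1)] continuous_on_box_average[OF cont(2)]
    unfolding box_average_def by auto
  have C_even: "?C (- x) = ?C x" and S_odd: "?S (- x) = - ?S x" for x
  proof -
    have refl: "integral {-1/2..1/2} (\<lambda>u. f (- x + u)) = integral {-1/2..1/2} (\<lambda>u. f (- (x + u)))"
      for f :: "real \<Rightarrow> real"
      using Henstock_Kurzweil_Integration.integral_reflect_real[of "1/2" "-1/2" "\<lambda>u. f (- x + u)"]
      by simp
    show "?C (- x) = ?C x" "?S (- x) = - ?S x"
      unfolding box_average_def refl by (simp_all only: c_even s_odd integral_neg)
  qed
  have shift: "x + 1 + u = (x + u) + 1" for x u :: real by simp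
  have C_shift: "?C (x + 1) = cos (2 * \<phi>) * ?C x - sin (2 * \<phi>) * ?S x" for x
    unfolding box_average_def shift c_shift
    by (subst Henstock_Kurzweil_Integration.integral_diff)
       (intro integrable_on_mult_right int | simp)+
  have S_shift: "?S (x + 1) = sin (2 * \<phi>) * ?C x + cos (2 * \<phi>) * ?S x" for x
    unfolding box_average_def shift s_shift
    by (subst Henstock_Kurzweil_Integration.integral_add)
       (intro integrable_on_mult_right int | simp)+
  have sin: "0 \<le> sin \<phi>" and cos: "0 \<le> cos \<phi>"
    using \<phi> by (auto intro: sin_ge_zero cos_ge_zero)
  have sc: "sin \<phi> * sin \<phi> = 1 - cos \<phi> * cos \<phi>"
    using sin_cos_squared_add[of \<phi>] by (simp add: power2_eq_square)
  have double: "cos (2 * \<phi>) = 1 - 2 * sin \<phi> * sin \<phi>" "sin (2 * \<phi>) = 2 * sin \<phi> * cos \<phi>"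
    by (simp_all add: cos_double_sin sin_double power2_eq_square)
  \<comment> \<open>Since \<open>x + 1/2 = - (1/2 - x) + 1\<close> and
    \<open>x - 1/2 = - (1/2 - x)\<close>, the shift rule and parity express both end values through
    \<open>c\<close> and \<open>s\<close> at \<open>1/2 - x\<close>. This point lies in [0, 1/2]
    together with \<open>x\<close>, where the signs are known.\<close>
  have dC: "(?C has_real_derivative
      - 2 * sin \<phi> * sin \<phi> * c (1/2 - x) + 2 * sin \<phi> * cos \<phi> * s (1/2 - x)) (at x)" for x
  proof -
    have "c (x + 1/2) = c (- (1/2 - x) + 1)" "c (x - 1/2) = c (- (1/2 - x))" by (auto simp: algebra_simps)
    then have "c (x + 1/2) - c (x - 1/2) = 
      - 2 * sin \<phi> * sin \<phi> * c (1/2 - x) + 2 * sin \<phi> * cos \<phi> * s (1/2 - x)"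
      unfolding c_shift by (simp only: c_even s_odd double) (simp add: algebra_simps)
    then show ?thesis using DERIV_box_average[OF cont(1), of x] by simp
  qed
  have dS: "(?S has_real_derivative
      2 * sin \<phi> * cos \<phi> * c (1/2 - x) + 2 * sin \<phi> * sin \<phi> * s (1/2 - x)) (at x)" for x
  proof -
    have "s (x + 1/2) = s (- (1/2 - x) + 1)" "s (x - 1/2) = s (- (1/2 - x))" by (auto simp: algebra_simps)
    then have "s (x + 1/2) - s (x - 1/2) = 
      2 * sin \<phi> * cos \<phi> * c (1/2 - x) + 2 * sin \<phi> * sin \<phi> * s (1/2 - x)"
      unfolding s_shift by (simp only: c_even s_odd double) (simp add: algebra_simps)
    then show ?thesis using DERIV_box_average[OF cont(2), of x] by simp
  qed
  have S_ge: "0 \<le> ?S x" if x: "0 \<le> x" "x \<le> 1/2" for x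
  proof -
    have "?S 0 = 0" using S_odd[of 0] by simp
    moreover have "?S 0 \<le> ?S x"
    proof (rule DERIV_nonneg_imp_nondecreasing[OF x(1)])
      fix y assume y: "0 \<le> y" "y \<le> x"
      show "\<exists>d. (?S has_real_derivative d) (at y) \<and> 0 \<le> d"
        using dS[of y] y x sin cos c_ge[of "1/2 - y"] s_ge[of "1/2 - y"]
        by - (rule exI, rule conjI, rule dS, auto)
    qed
    ultimately show ?thesis by simp
  qed
  \<comment> \<open>\<open>- V\<close> is the imaginary part of \<open>e\<^sup>-\<^sup>i\<^sup>\<phi> (C + i S)\<close>, which vanishes at \<open>1/2\<close> by symmetry about that point.\<close>
  define V where "V x = sin \<phi> * ?C x - cos \<phi> * ?S x" for x
  have V_half: "V (1/2) = 0"
  proof -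
    \<comment> \<open>The shift rule at -1/2 relates the values at 1/2 and -1/2; parity leaves two
      equations at 1/2 alone, which say that \<open>sin \<phi>\<close> and \<open>cos \<phi>\<close>
      both annihilate \<open>V (1/2)\<close>.\<close>
    have h: "?C (1/2) = cos (2 * \<phi>) * ?C (1/2) + sin (2 * \<phi>) * ?S (1/2)"
      "?S (1/2) = sin (2 * \<phi>) * ?C (1/2) - cos (2 * \<phi>) * ?S (1/2)"
      using C_shift[of "-(1/2)"] S_shift[of "-(1/2)"] by (simp_all only: C_even S_odd) simp_all
    have "sin \<phi> * V (1/2) = 0"
      using h(1) unfolding V_def double by (simp add: algebra_simps)
    moreover have "cos \<phi> * V (1/2) = 0"
      using h(2) sc unfolding V_def double by algebra
    moreover have "sin \<phi> \<noteq> 0 \<or> cos \<phi> \<noteq> 0" using sc by auto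
    ultimately show ?thesis by auto
  qed
  \<comment> \<open>The contributions of \<open>s\<close> cancel, so the sign of the derivative
    depends on \<open>c\<close> alone.\<close>
  have dV: "(V has_real_derivative - 2 * sin \<phi> * c (1/2 - x)) (at x)" for x
  proof -
    have "(V has_real_derivative
        sin \<phi> * (- 2 * sin \<phi> * sin \<phi> * c (1/2 - x) + 2 * sin \<phi> * cos \<phi> * s (1/2 - x))
        - cos \<phi> * (2 * sin \<phi> * cos \<phi> * c (1/2 - x) + 2 * sin \<phi> * sin \<phi> * s (1/2 - x))) (at x)"
      unfolding V_def by (intro DERIV_diff DERIV_cmult dC dS)
    moreover have "sin \<phi> * (- 2 * sin \<phi> * sin \<phi> * a + 2 * sin \<phi> * cos \<phi> * b)
        - cos \<phi> * (2 * sin \<phi> * cos \<phi> * a + 2 * sin \<phi> * sin \<phi> * b) = - 2 * sin \<phi> * a" for a b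
      using sc by algebra
    ultimately show ?thesis by metis
  qed
  have V_ge: "0 \<le> V x" if x: "0 \<le> x" "x \<le> 1/2" for x
  proof -
    have "V (1/2) \<le> V x"
    proof (rule DERIV_nonpos_imp_nonincreasing[OF x(2)])
      fix y assume y: "x \<le> y" "y \<le> 1/2"
      show "\<exists>d. (V has_real_derivative d) (at y) \<and> d \<le> 0"
        using dV[of y] y x sin c_ge[of "1/2 - y"]
        by - (rule exI, rule conjI, rule dV, auto)
    qed
    then show ?thesis using V_half by simp
  qed
  have C0: "0 < ?C 0"
  proof -
    have c_ge': "0 \<le> c u" if "u \<in> {-1/2..1/2}" for u
      using c_ge[of u] c_ge[of "- u"] c_even[of u] that by (cases "0 \<le> u") auto
    have "0 \<le> ?C 0"
      unfolding box_average_def using c_ge' by (intro integral_nonneg) (use int[of 0] in auto)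
    moreover have "?C 0 \<noteq> 0"
    proof
      assume "?C 0 = 0"
      then have "\<forall>u\<in>{-1/2..1/2}. c u = 0"
        unfolding box_average_def
        using integral_eq_0_iff[of "-1/2" "1/2" c] c_ge' continuous_on_subset[OF cont(1)] by auto
      then show False using c0 by auto
    qed
    ultimately show ?thesis by simp
  qed
  have C_ge: "0 \<le> ?C x" if x: "0 \<le> x" "x \<le> 1/2" for x
  \<comment> \<open>If \<open>sin \<phi> = 0\<close>, then \<open>V\<close> says nothing about
    \<open>?C\<close>, but the derivative of \<open>?C\<close> vanishes and \<open>?C\<close> is
    constant.\<close>
  proof (cases "sin \<phi> = 0")
    case True
    have "?C x = ?C 0"
      by (rule DERIV_isconst_all) (use dC True in auto)
    then show ?thesis using C0 by simp
  next
    case False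
    have "0 \<le> sin \<phi> * ?C x"
      using V_ge[OF x] mult_nonneg_nonneg[OF cos S_ge[OF x]] unfolding V_def by linarith
    then show ?thesis using False sin by (simp add: zero_le_mult_iff)
  qed
  show ?thesis
    unfolding euler_pair_def
    using contC C_even S_odd C_shift S_shift C_ge S_ge C0 by auto
qed

section \<open>Series of integer translates of a B-spline\<close>

lemma infsum_finite_support:
  assumes "finite A" "\<And>x. x \<notin> A \<Longrightarrow> f x = 0"
  shows "infsum f UNIV = sum f A"
proof -
  have "infsum f UNIV = infsum f A"
    by (rule infsum_cong_neutral) (use assms in auto)
  then show ?thesis using assms by simp
qed

text \<open>Arbitrary real weights cover the real and the imaginary part of the Euler spline, and
  they let shifts and reflections of \<open>x\<close> act on \<open>w\<close>.\<close>

definition bspline_series :: "nat \<Rightarrow> (int \<Rightarrow> real) \<Rightarrow> real \<Rightarrow> real" where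
  "bspline_series p w x = (\<Sum>\<^sub>\<infinity>k. bspline p (x - of_int k) * w k)"

text \<open>One window \<open>-N..N\<close> serves all arguments in a bounded set, so continuity and
  integration can be treated under a finite sum.\<close>

lemma bspline_series_eq_sum:
  assumes "0 < p" "\<bar>x\<bar> + real p + 1 \<le> of_int N"
  shows "bspline_series p w x = (\<Sum>k=-N..N. bspline p (x - of_int k) * w k)"
  unfolding bspline_series_def
proof (rule infsum_finite_support)
  fix k assume "k \<notin> {-N..N}"
  then have "of_int N < \<bar>of_int k :: real\<bar>" by auto
  then have "bspline p (x - of_int k) = 0" using assms by (intro bspline_eq_0) auto
  then show "bspline p (x - of_int k) * w k = 0" by simp
qed simp

lemma continuous_bspline_series:
  assumes p: "0 < p"
  shows "continuous_on UNIV (bspline_series p w)"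
  unfolding continuous_on_eq_continuous_at[OF open_UNIV]
proof
  fix x :: real
  \<comment> \<open>The summand 1 makes the window valid on the whole unit ball around
    \<open>x\<close>.\<close>
  define N where "N = \<lceil>\<bar>x\<bar> + 1 + real p + 1\<rceil>"
  have "continuous_on (ball x 1) (\<lambda>y. \<Sum>k=-N..N. bspline p (y - of_int k) * w k)"
    by (intro continuous_intros continuous_on_compose2[OF continuous_bspline[OF p]]) auto
  moreover have "(\<Sum>k=-N..N. bspline p (y - of_int k) * w k) = bspline_series p w y" if "y \<in> ball x 1" for y
  proof (rule bspline_series_eq_sum[OF p, symmetric])
    have "\<bar>y\<bar> \<le> \<bar>x\<bar> + 1" using that by (auto simp: dist_real_def)
    then show "\<bar>y\<bar> + real p + 1 \<le> of_int N" unfolding N_def by linarith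
  qed
  ultimately have "continuous_on (ball x 1) (bspline_series p w)"
    by (rule continuous_on_eq)
  then show "isCont (bspline_series p w) x"
    by (simp add: continuous_on_eq_continuous_at)
qed

lemma bspline_series_Suc:
  assumes p: "0 < p"
  shows "bspline_series (Suc p) w = box_average (bspline_series p w)"
proof
  fix x :: real
  \<comment> \<open>The summand 1 covers the arguments \<open>x + u\<close> in degree
    \<open>p\<close>, and also the wider support bound of degree \<open>Suc p\<close>.\<close>
  define N where "N = \<lceil>\<bar>x\<bar> + 1 + real p + 1\<rceil>"
  have N: "\<bar>x\<bar> + 1 + real p + 1 \<le> of_int N" unfolding N_def by linarith
  have "box_average (bspline_series p w) x
      = integral {-1/2..1/2} (\<lambda>u. \<Sum>k=-N..N. bspline p ((x - of_int k) + u) * w k)"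
    unfolding box_average_def
  proof (rule Henstock_Kurzweil_Integration.integral_cong)
    fix u :: real assume "u \<in> {-1/2..1/2}"
    then have "\<bar>x + u\<bar> + real p + 1 \<le> of_int N" using N by auto
    then show "bspline_series p w (x + u) = (\<Sum>k=-N..N. bspline p ((x - of_int k) + u) * w k)"
      using bspline_series_eq_sum[OF p] by (simp add: algebra_simps)
  qed
  also have "\<dots> = (\<Sum>k=-N..N. integral {-1/2..1/2} (\<lambda>u. bspline p ((x - of_int k) + u) * w k))"
    by (intro Henstock_Kurzweil_Integration.integral_sum integrable_continuous_interval continuous_intros
        continuous_on_compose2[OF continuous_bspline[OF p]]) auto
  also have "\<dots> = (\<Sum>k=-N..N. bspline (Suc p) (x - of_int k) * w k)"
    using bspline_Suc[OF p] by (simp del: bspline.simps)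
  also have "\<dots> = bspline_series (Suc p) w x"
    by (rule bspline_series_eq_sum[symmetric]) (use N in auto)
  finally show "bspline_series (Suc p) w x = box_average (bspline_series p w) x" ..
qed

lemma bspline_series_minus:
  assumes p: "0 < p"
  shows "bspline_series p w (- x) = bspline_series p (\<lambda>k. w (- k)) x"
  unfolding bspline_series_def
  by (rule infsum_reindex_bij_witness[of _ uminus uminus])
     (use bspline_minus[OF p, of "x + of_int k" for k] in \<open>auto simp: algebra_simps\<close>)

lemma bspline_series_shift:
  "bspline_series p w (x + of_int n) = bspline_series p (\<lambda>k. w (k + n)) x"
  unfolding bspline_series_def
  by (rule infsum_reindex_bij_witness[of _ "\<lambda>k. k + n" "\<lambda>k. k - n"]) (auto simp: algebra_simps)

lemma bspline_series_lincomb: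
  assumes p: "0 < p"
  shows "bspline_series p (\<lambda>k. a * v k + b * w k) x = a * bspline_series p v x + b * bspline_series p w x"
proof -
  define N where "N = \<lceil>\<bar>x\<bar> + real p + 1\<rceil>"
  have N: "\<bar>x\<bar> + real p + 1 \<le> of_int N" unfolding N_def by linarith
  show ?thesis
    unfolding bspline_series_eq_sum[OF p N]
    by (simp add: sum_distrib_left sum.distrib algebra_simps)
qed

text \<open>The real form of f (x + n) = exp (i n \<theta>) f x: the shift moves to the weights,
  where the addition formulas apply.\<close>

lemma bspline_series_shift_trig:
  fixes \<theta> :: real
  assumes p: "0 < p"
  defines "c \<equiv> bspline_series p (\<lambda>k. cos (\<theta> * of_int k))"
  defines "s \<equiv> bspline_series p (\<lambda>k. sin (\<theta> * of_int k))"
  shows "c (x + of_int n) = cos (\<theta> * of_int n) * c x - sin (\<theta> * of_int n) * s x"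
    and "s (x + of_int n) = sin (\<theta> * of_int n) * c x + cos (\<theta> * of_int n) * s x"
  unfolding c_def s_def bspline_series_shift
  using bspline_series_lincomb[OF p, of "cos (\<theta> * of_int n)" "\<lambda>k. cos (\<theta> * of_int k)" "- sin (\<theta> * of_int n)" "\<lambda>k. sin (\<theta> * of_int k)" x]
    bspline_series_lincomb[OF p, of "sin (\<theta> * of_int n)" "\<lambda>k. cos (\<theta> * of_int k)" "cos (\<theta> * of_int n)" "\<lambda>k. sin (\<theta> * of_int k)" x]
  by (simp_all add: distrib_left cos_add sin_add mult.commute add.commute)

text \<open>On [0, 1] only the hats centred at 0 and 1 can be nonzero, so the series interpolates
  the weights linearly.\<close>

lemma bspline_series_1:
  assumes "0 \<le> x" "x \<le> 1"
  shows "bspline_series (Suc 0) w x = (1 - x) * w 0 + x * w 1"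
proof -
  have "bspline_series (Suc 0) w x = (\<Sum>k\<in>{0, 1}. bspline (Suc 0) (x - of_int k) * w k)"
    unfolding bspline_series_def
  proof (rule infsum_finite_support)
    fix k :: int assume "k \<notin> {0, 1}"
    then have "k \<le> -1 \<or> 2 \<le> k" by auto
    then have "real_of_int k \<le> -1 \<or> 2 \<le> real_of_int k" by linarith
    then have "bspline (Suc 0) (x - of_int k) = 0"
      unfolding bspline_1 using assms by auto
    then show "bspline (Suc 0) (x - of_int k) * w k = 0" by simp
  qed simp
  then show ?thesis using assms by (simp add: bspline_1 del: bspline.simps)
qed

text \<open>In degree 1 linear interpolation gives the parts
  \<open>1 - x + x * cos (2 * \<phi>)\<close>, at least \<open>1 - 2 * x\<close>, and
  \<open>x * sin (2 * \<phi>)\<close>. Both are nonnegative on [0, 1/2], and averaging preserves the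
  property.\<close>

lemma euler_pair_bspline_series:
  assumes \<phi>: "0 \<le> \<phi>" "\<phi> \<le> pi / 2" and p: "0 < p"
  shows "euler_pair \<phi> (bspline_series p (\<lambda>k. cos (2 * \<phi> * of_int k)))
    (bspline_series p (\<lambda>k. sin (2 * \<phi> * of_int k)))"
  using p
proof (induction p rule: nat_induct_non_zero)
  case 1
  have "0 \<le> (1 - x) + x * cos (2 * \<phi>)" if "0 \<le> x" "x \<le> 1/2" for x
  proof -
    have "x * (-1) \<le> x * cos (2 * \<phi>)" using that by (intro mult_left_mono) auto
    then show ?thesis using that by simp
  qed
  moreover have "0 \<le> sin (2 * \<phi>)" using \<phi> by (intro sin_ge_zero) auto
  moreover have "bspline_series 1 (\<lambda>k. sin (2 * \<phi> * of_int k)) (- x) = - bspline_series 1 (\<lambda>k. sin (2 * \<phi> * of_int k)) x" for x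
    using bspline_series_lincomb[of 1 "-1" "\<lambda>k. sin (2 * \<phi> * of_int k)" 0 "\<lambda>_. 0" x]
    by (simp add: bspline_series_minus)
  ultimately show ?case
    unfolding euler_pair_def
    using bspline_series_shift_trig[of 1 "2 * \<phi>" _ 1]
    by (auto simp: continuous_bspline_series bspline_series_minus bspline_series_1)
next
  case (Suc p)
  then show ?case
    using euler_pair_box_average[OF \<phi>] by (simp add: bspline_series_Suc)
qed

lemma bspline_symbol_pos:
  assumes \<theta>: "0 \<le> \<theta>" "\<theta> \<le> pi" and p: "0 < p"
  shows "0 < bspline_series p (\<lambda>k. cos (\<theta> * of_int k)) 0"
  using euler_pair_bspline_series[of "\<theta> / 2" p] assms by (simp add: euler_pair_def)

section \<open>The sampled autocorrelation and its symbol\<close>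

text \<open>Fixed to real values for the analysis; \<open>downsample_autocorrelation_of_real\<close>
  carries it over to \<open>'a\<close>. As the B-spline is even, the convolution is an
  autocorrelation.\<close>

definition sampled_autocorrelation :: "nat \<Rightarrow> nat \<Rightarrow> int \<Rightarrow> real" where
  "sampled_autocorrelation p q = downsample q (sampled_bspline p q \<star> sampled_bspline p q)"

lemma sampled_convolution_summand_eq_0:
  assumes p: "0 < p" and "\<not> \<bar>of_int l / real q\<bar> < real p + 1 \<or> \<not> \<bar>of_int k / real q - of_int l / real q\<bar> < real p + 1"
  shows "bspline p (of_int (k - l) / real q) * bspline p (of_int l / real q) = 0"
  using assms bspline_eq_0[OF p, of "of_int l / real q"] bspline_eq_0[OF p, of "of_int (k - l) / real q"]
  by (auto simp: diff_divide_distrib)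

text \<open>The summation index is split by its residue \<open>r\<close> modulo \<open>q\<close> as
  \<open>l = r - q * m\<close>, and evenness rewrites the first factor. The sign of \<open>m\<close>
  is chosen so that the arguments have the form used in \<open>bspline_series\<close>.\<close>

lemma sampled_autocorrelation_alt:
  assumes p: "0 < p" and q: "1 \<le> q"
  shows "sampled_autocorrelation p q j = (\<Sum>r=0..<int q. \<Sum>m=-int (p + 2)..int (p + 2).
    bspline p (of_int r / real q - of_int m) * bspline p (of_int r / real q - of_int m - of_int j))"
proof -
  let ?F = "\<lambda>l. bspline p (of_int (int q * j - l) / real q) * bspline p (of_int l / real q)"
  let ?h = "\<lambda>(r, m). r - int q * m"
  let ?A = "{0..<int q} \<times> {-int (p + 2)..int (p + 2)}"
  have bij: "bij_betw ?h ({0..<int q} \<times> UNIV) UNIV"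
  proof (rule bij_betwI[where g = "\<lambda>l. (l mod int q, - (l div int q))"])
    fix x assume "x \<in> {0..<int q} \<times> (UNIV :: int set)"
    then obtain r m where x: "x = (r, m)" "0 \<le> r" "r < int q" by auto
    then have "(r - int q * m) mod int q = r" "(r - int q * m) div int q = - m"
      using mod_mult_self2[of r "int q" "- m"] div_mult_self2[of "int q" r "- m"] by simp_all
    then show "(?h x mod int q, - (?h x div int q)) = x" by (simp add: x)
  qed (use q in auto)
  have eq: "of_int (r - int q * m) / real q = of_int r / real q - of_int m" for r m
    using q by (simp add: diff_divide_distrib)
  have F: "?F (r - int q * m) = bspline p (of_int r / real q - of_int m)
     * bspline p (of_int r / real q - of_int m - of_int j)" for r m
  proof -
    have "of_int (int q * j - (r - int q * m)) / real q = - (of_int r / real q - of_int m - of_int j)"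
      using q by (simp add: field_simps)
    then show ?thesis by (simp only: bspline_minus[OF p] eq) (simp only: mult.commute)
  qed
  have "sampled_autocorrelation p q j = infsum ?F UNIV"
    unfolding sampled_autocorrelation_def downsample_def convolution_int_def sampled_bspline_def by simp
  also have "\<dots> = infsum (\<lambda>x. ?F (?h x)) ({0..<int q} \<times> UNIV)"
    by (rule infsum_reindex_bij_betw[OF bij, symmetric])
  also have "\<dots> = infsum (\<lambda>x. ?F (?h x)) ?A"
  proof (rule infsum_cong_neutral)
    fix x assume xA: "x \<in> {0..<int q} \<times> UNIV - ?A"
    obtain r m where x: "x = (r, m)" by (cases x)
    have r: "0 \<le> r" "r < int q" and m: "\<not> (- int (p + 2) \<le> m \<and> m \<le> int (p + 2))"
      using xA unfolding x by auto
    \<comment> \<open>As \<open>r / q\<close> lies in [0, 1), an index \<open>m\<close> beyond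
      \<open>p + 2\<close> leaves a distance of at least \<open>p + 1\<close>.\<close>
    have "0 \<le> of_int r / real q" "of_int r / real q < 1" using r by auto
    moreover have "real p + 2 < \<bar>of_int m :: real\<bar>" using m by linarith
    ultimately have "\<not> \<bar>of_int r / real q - of_int m\<bar> < real p + 1" by linarith
    then show "?F (?h x) = 0"
      unfolding x split_conv by (intro sampled_convolution_summand_eq_0[OF p]) (simp add: eq del: of_int_diff)
  qed auto
  also have "\<dots> = (\<Sum>(r, m)\<in>?A. ?F (r - int q * m))" by (simp add: case_prod_unfold)
  also have "\<dots> = (\<Sum>r=0..<int q. \<Sum>m=-int (p + 2)..int (p + 2). ?F (r - int q * m))"
    by (rule sum.cartesian_product[symmetric])
  finally show ?thesis by (simp only: F)
qed

text \<open>The arguments of the two factors add up to \<open>j\<close>, so one of them has modulus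
  at least \<open>p + 1\<close>.\<close>

lemma sampled_autocorrelation_eq_0:
  assumes p: "0 < p" and q: "1 \<le> q" and j: "int (2 * p + 2) < \<bar>j\<bar>"
  shows "sampled_autocorrelation p q j = 0"
proof -
  have "bspline p (of_int (int q * j - l) / real q) * bspline p (of_int l / real q) = 0" for l
  proof -
    have "2 * real p + 2 < \<bar>of_int j :: real\<bar>" using j by linarith
    moreover have "of_int (int q * j) / real q = of_int j" using q by simp
    ultimately show ?thesis by (intro sampled_convolution_summand_eq_0[OF p]) linarith
  qed
  then show ?thesis
    unfolding sampled_autocorrelation_def downsample_def convolution_int_def sampled_bspline_def
      of_real_eq_id id_apply by (intro infsum_0)
qed

lemma sampled_autocorrelation_minus:
  assumes p: "0 < p"
  shows "sampled_autocorrelation p q (- j) = sampled_autocorrelation p q j"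
proof -
  let ?b = "sampled_bspline p q :: int \<Rightarrow> real"
  have b_even: "?b (- k) = ?b k" for k
    using bspline_minus[OF p, of "of_int k / real q"] by (simp add: sampled_bspline_def)
  have "?b (int q * - j - l) * ?b l = ?b (int q * j - - l) * ?b (- l)" for l
    using b_even[of "int q * j + l"] b_even[of l] by simp
  then show ?thesis
    unfolding sampled_autocorrelation_def downsample_def convolution_int_def
    by (intro infsum_reindex_bij_witness[of _ uminus uminus]) simp_all
qed

text \<open>For fixed \<open>r\<close> the sum over \<open>m\<close> and \<open>j\<close> is the
  Fourier sum of an autocorrelation, hence the squared modulus of the Euler spline at
  \<open>r / q\<close>.\<close>

lemma sampled_autocorrelation_symbol:
  fixes \<theta> :: real
  assumes p: "0 < p" and q: "1 \<le> q"
  defines "c \<equiv> bspline_series p (\<lambda>k. cos (\<theta> * of_int k))"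
  defines "s \<equiv> bspline_series p (\<lambda>k. sin (\<theta> * of_int k))"
  shows "(\<Sum>j=-int (2 * p + 2)..int (2 * p + 2). sampled_autocorrelation p q j * cos (\<theta> * of_int j))
    = (\<Sum>r=0..<int q. (c (of_int r / real q))\<^sup>2 + (s (of_int r / real q))\<^sup>2)"
proof -
  let ?M = "{-int (p + 2)..int (p + 2)}"
  \<comment> \<open>Wherever \<open>?b r m\<close> is nonzero, \<open>?x r - m\<close> has modulus
    below \<open>p + 1\<close>, so this window contains the whole support of the inner sum over
    \<open>j\<close>. The autocorrelation vanishes at the added indices.\<close>
  define N where "N = int (2 * p + 4)"
  let ?x = "\<lambda>r :: int. of_int r / real q"
  let ?b = "\<lambda>r m :: int. bspline p (?x r - of_int m)"
  let ?b' = "\<lambda>r m j :: int. bspline p (?x r - of_int m - of_int j) * cos (\<theta> * of_int j)"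
  have x: "0 \<le> ?x r" "?x r < 1" if "r \<in> {0..<int q}" for r using that by auto
  have "(\<Sum>j=-int (2 * p + 2)..int (2 * p + 2). sampled_autocorrelation p q j * cos (\<theta> * of_int j))
      = (\<Sum>j=-N..N. sampled_autocorrelation p q j * cos (\<theta> * of_int j))"
    by (rule sum.mono_neutral_left) (auto simp: N_def intro!: sampled_autocorrelation_eq_0[OF p q])
  also have "\<dots> = (\<Sum>j=-N..N. \<Sum>r=0..<int q. \<Sum>m\<in>?M. ?b r m * ?b' r m j)"
    unfolding sampled_autocorrelation_alt[OF p q] by (simp add: sum_distrib_right mult.assoc)
  also have "\<dots> = (\<Sum>r=0..<int q. \<Sum>m\<in>?M. ?b r m * (\<Sum>j=-N..N. ?b' r m j))"
    unfolding sum_distrib_left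
    by (subst sum.swap, rule sum.cong[OF refl], rule sum.swap)
  also have "\<dots> = (\<Sum>r=0..<int q. (c (?x r))\<^sup>2 + (s (?x r))\<^sup>2)"
  proof (rule sum.cong[OF refl])
    fix r assume r: "r \<in> {0..<int q}"
    have "?b r m * (\<Sum>j=-N..N. ?b' r m j) = 
        ?b r m * cos (\<theta> * of_int m) * c (?x r) + ?b r m * sin (\<theta> * of_int m) * s (?x r)"
      (is "_ = ?R") if m: "m \<in> ?M" for m
    \<comment> \<open>In the nonzero case the inner sum is \<open>c\<close> at
      \<open>?x r - m\<close>, and the shift rule separates \<open>m\<close> from
      \<open>?x r\<close>.\<close>
    proof (cases "?b r m = 0")
      case False
      then have "\<bar>?x r - of_int m\<bar> < real p + 1" using bspline_eq_0[OF p] by force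
      then have "(\<Sum>j=-N..N. ?b' r m j) = c (?x r + of_int (- m))"
        unfolding c_def using bspline_series_eq_sum[OF p, of "?x r - of_int m" N "\<lambda>k. cos (\<theta> * of_int k)"]
        by (simp add: N_def)
      also have "\<dots> = cos (\<theta> * of_int m) * c (?x r) + sin (\<theta> * of_int m) * s (?x r)"
        using bspline_series_shift_trig(1)[OF p, of \<theta> "?x r" "- m"] unfolding c_def s_def by simp
      finally show ?thesis by (simp add: algebra_simps)
    qed simp
    then have "(\<Sum>m\<in>?M. ?b r m * (\<Sum>j=-N..N. ?b' r m j)) =
        (\<Sum>m\<in>?M. ?b r m * cos (\<theta> * of_int m)) * c (?x r) + (\<Sum>m\<in>?M. ?b r m * sin (\<theta> * of_int m)) * s (?x r)"
      by (simp add: sum.distrib sum_distrib_right)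
    moreover have "\<bar>?x r\<bar> + real p + 1 \<le> of_int (int (p + 2))" using x[OF r] by auto
    note bspline_series_eq_sum[OF p this, symmetric]
    ultimately show "(\<Sum>m\<in>?M. ?b r m * (\<Sum>j=-N..N. ?b' r m j)) = (c (?x r))\<^sup>2 + (s (?x r))\<^sup>2"
      unfolding c_def s_def power2_eq_square by (simp only:)
  qed
  finally show ?thesis .
qed

text \<open>The symbol is a sum of squares, and its term for \<open>r = 0\<close> is positive by
  \<open>bspline_symbol_pos\<close>.\<close>

lemma sampled_autocorrelation_symbol_pos:
  assumes p: "0 < p" and q: "1 \<le> q" and \<theta>: "0 \<le> \<theta>" "\<theta> \<le> pi"
  shows "0 < (\<Sum>j=-int (2 * p + 2)..int (2 * p + 2). sampled_autocorrelation p q j * cos (\<theta> * of_int j))"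
  unfolding sampled_autocorrelation_symbol[OF p q]
proof (rule sum_pos2)
  show "0 \<in> {0..<int q}" using q by simp
  show "0 < (bspline_series p (\<lambda>k. cos (\<theta> * of_int k)) (of_int 0 / real q))\<^sup>2
      + (bspline_series p (\<lambda>k. sin (\<theta> * of_int k)) (of_int 0 / real q))\<^sup>2"
    using bspline_symbol_pos[OF \<theta> p] by (simp add: add_pos_nonneg)
qed simp_all

subsection \<open>Inversion of positive symbols\<close>

text \<open>A substitute for being a trigonometric polynomial of degree at most \<open>m\<close>: it
  keeps only the vanishing of the higher cosine coefficients.\<close>

definition cosine_orthogonal :: "int \<Rightarrow> (real \<Rightarrow> real) \<Rightarrow> bool" where
  "cosine_orthogonal m t \<longleftrightarrow> continuous_on {0..pi} t \<and>
    (\<forall>k. m < \<bar>k\<bar> \<longrightarrow> integral {0..pi} (\<lambda>\<theta>. t \<theta> * cos (\<theta> * of_int k)) = 0)"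

lemma integral_cos_int:
  "integral {0..pi} (\<lambda>\<theta>. cos (\<theta> * of_int k)) = (if k = 0 then pi else 0)"
proof (cases "k = 0")
  case False
  have "((\<lambda>\<theta>. cos (\<theta> * of_int k)) has_integral sin (pi * of_int k) / of_int k - sin (0 * of_int k) / of_int k) {0..pi}"
    by (rule fundamental_theorem_of_calculus)
      (use False in \<open>auto simp: has_real_derivative_iff_has_vector_derivative[symmetric] intro!: derivative_eq_intros\<close>)
  then show ?thesis using False sin_zero_iff_int2[of "pi * of_int k"]
    by (auto simp: integral_unique mult.commute)
qed simp

lemma cosine_orthogonal_const: "cosine_orthogonal 0 (\<lambda>_. a)"
  by (auto simp: cosine_orthogonal_def integral_cos_int)

lemma cosine_orthogonal_mono: "cosine_orthogonal m t \<Longrightarrow> m \<le> n \<Longrightarrow> cosine_orthogonal n t"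
  by (auto simp: cosine_orthogonal_def)

lemma cosine_orthogonal_add:
  assumes "cosine_orthogonal m t" "cosine_orthogonal m u"
  shows "cosine_orthogonal m (\<lambda>\<theta>. t \<theta> + u \<theta>)"
  using assms unfolding cosine_orthogonal_def
  by (auto simp: distrib_right intro!: continuous_intros trans[OF Henstock_Kurzweil_Integration.integral_add] integrable_continuous_interval)

lemma cosine_orthogonal_sum:
  assumes "finite A" "\<And>i. i \<in> A \<Longrightarrow> cosine_orthogonal m (t i)" "0 \<le> m"
  shows "cosine_orthogonal m (\<lambda>\<theta>. \<Sum>i\<in>A. t i \<theta>)"
  using assms
  by (induction A rule: finite_induct)
    (auto intro: cosine_orthogonal_add cosine_orthogonal_mono[OF cosine_orthogonal_const[of 0]])

text \<open>The product of two cosines is half the sum of the cosines with frequencies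
  \<open>j + k\<close> and \<open>j - k\<close>, both of modulus above \<open>m\<close> once
  \<open>k\<close> exceeds \<open>m + n\<close> in modulus.\<close>

lemma cosine_orthogonal_mult_cos:
  assumes t: "cosine_orthogonal m t" and j: "\<bar>j\<bar> \<le> n"
  shows "cosine_orthogonal (m + n) (\<lambda>\<theta>. a * cos (\<theta> * of_int j) * t \<theta>)"
  unfolding cosine_orthogonal_def
proof (intro conjI allI impI)
  have c: "continuous_on {0..pi} t" using t by (simp add: cosine_orthogonal_def)
  then show "continuous_on {0..pi} (\<lambda>\<theta>. a * cos (\<theta> * of_int j) * t \<theta>)"
    by (intro continuous_intros)
  fix k :: int assume k: "m + n < \<bar>k\<bar>"
  have "a * cos (\<theta> * of_int j) * t \<theta> * cos (\<theta> * of_int k) =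
      a / 2 * (t \<theta> * cos (\<theta> * of_int (j + k))) + a / 2 * (t \<theta> * cos (\<theta> * of_int (j - k)))" for \<theta>
    by (simp add: distrib_left right_diff_distrib cos_add cos_diff)
  then have "integral {0..pi} (\<lambda>\<theta>. a * cos (\<theta> * of_int j) * t \<theta> * cos (\<theta> * of_int k)) =
     a / 2 * integral {0..pi} (\<lambda>\<theta>. t \<theta> * cos (\<theta> * of_int (j + k)))
     + a / 2 * integral {0..pi} (\<lambda>\<theta>. t \<theta> * cos (\<theta> * of_int (j - k)))"
    using c by (simp only:) (subst Henstock_Kurzweil_Integration.integral_add,
      auto intro!: integrable_continuous_interval continuous_intros)
  also have "\<dots> = 0"
  proof -
    have "integral {0..pi} (\<lambda>\<theta>. t \<theta> * cos (\<theta> * of_int i)) = 0" if "m < \<bar>i\<bar>" for i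
      using t that by (simp add: cosine_orthogonal_def)
    moreover have "m < \<bar>j + k\<bar>" "m < \<bar>j - k\<bar>" using k j by linarith+
    ultimately show ?thesis by (simp only: mult_zero_right add_0)
  qed
  finally show "integral {0..pi} (\<lambda>\<theta>. a * cos (\<theta> * of_int j) * t \<theta> * cos (\<theta> * of_int k)) = 0" .
qed

lemma cosine_orthogonal_power:
  assumes t: "\<And>\<theta>. t \<theta> = (\<Sum>j=-n..n. a j * cos (\<theta> * of_int j))" and n: "0 \<le> n"
  shows "cosine_orthogonal (int i * n) (\<lambda>\<theta>. t \<theta> ^ i)"
proof (induction i)
  case 0
  then show ?case using cosine_orthogonal_const[of 1] by simp
next
  case (Suc i)
  have "cosine_orthogonal (int i * n + n) (\<lambda>\<theta>. \<Sum>j=-n..n. a j * cos (\<theta> * of_int j) * t \<theta> ^ i)"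
    by (intro cosine_orthogonal_sum cosine_orthogonal_mult_cos Suc) (use n in auto)
  then show ?case by (simp add: t sum_distrib_right algebra_simps)
qed

text \<open>The inverse is the sequence of Fourier coefficients of \<open>1 / G\<close>. It decays exponentially
  because the partial sums of the geometric series of \<open>1 / (1 - (1 - G / M))\<close> are trigonometric
  polynomials which approximate \<open>1 / G\<close> at a geometric rate.\<close>

lemma exponentially_decaying_convolution_inverse:
  fixes g :: "int \<Rightarrow> real"
  assumes N: "1 \<le> N"
    and even: "\<And>j. g (- j) = g j"
    and pos: "\<And>\<theta>. 0 \<le> \<theta> \<Longrightarrow> \<theta> \<le> pi \<Longrightarrow> 0 < (\<Sum>j=-int N..int N. g j * cos (\<theta> * of_int j))"
  shows "\<exists>h :: int \<Rightarrow> real. exponential_decay h \<and>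
    (\<forall>k. (\<Sum>j=-int N..int N. g j * h (k - j)) = delta0 k)"
proof -
  define G where "G \<theta> = (\<Sum>j=-int N..int N. g j * cos (\<theta> * of_int j))" for \<theta>
  define h where "h k = integral {0..pi} (\<lambda>\<theta>. inverse (G \<theta>) * cos (\<theta> * of_int k)) / pi" for k :: int
  have G_pos: "0 < G \<theta>" if "\<theta> \<in> {0..pi}" for \<theta>
    using pos[of \<theta>] that by (simp add: G_def)
  have G_cont: "continuous_on A G" for A
    unfolding G_def by (intro continuous_intros)
  have iG_cont: "continuous_on {0..pi} (\<lambda>\<theta>. inverse (G \<theta>))"
    by (intro continuous_intros G_cont) (use G_pos in force)
  have "\<exists>a\<in>{0..pi}. \<forall>\<theta>\<in>{0..pi}. G a \<le> G \<theta>"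
    by (rule continuous_attains_inf) (auto intro: G_cont)
  then obtain a where a: "a \<in> {0..pi}" "\<And>\<theta>. \<theta> \<in> {0..pi} \<Longrightarrow> G a \<le> G \<theta>" by blast
  have "\<exists>b\<in>{0..pi}. \<forall>\<theta>\<in>{0..pi}. G \<theta> \<le> G b"
    by (rule continuous_attains_sup) (auto intro: G_cont)
  then obtain b where b: "b \<in> {0..pi}" "\<And>\<theta>. \<theta> \<in> {0..pi} \<Longrightarrow> G \<theta> \<le> G b" by blast
  \<comment> \<open>With twice the maximum, \<open>U\<close> is at least 1/2, so \<open>r\<close> is
    positive even when \<open>G\<close> is constant.\<close>
  define M where "M = 2 * G b"
  define r where "r = 1 - G a / M"
  have M: "0 < M" using G_pos[OF b(1)] by (simp add: M_def)
  have r: "0 < r" "r < 1"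
    using G_pos[OF a(1)] G_pos[OF b(1)] a(2)[OF b(1)] by (auto simp: r_def M_def divide_simps)
  define U where "U \<theta> = 1 - G \<theta> / M" for \<theta>
  have U_bounds: "0 \<le> U \<theta>" "U \<theta> \<le> r" if "\<theta> \<in> {0..pi}" for \<theta>
    using a(2)[OF that] b(2)[OF that] M G_pos[OF that] by (auto simp: U_def r_def M_def divide_simps)
  \<comment> \<open>The constant 1 is the cosine sum with coefficients \<open>delta0\<close>; this
    form lets \<open>cosine_orthogonal_power\<close> apply to \<open>U\<close>.\<close>
  have U_trig: "U \<theta> = (\<Sum>j=-int N..int N. (delta0 j - g j / M) * cos (\<theta> * of_int j))" for \<theta>
  proof -
    have "(\<Sum>j=-int N..int N. delta0 j * cos (\<theta> * of_int j)) = (\<Sum>j\<in>{0}. delta0 j * cos (\<theta> * of_int j))"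
      by (rule sum.mono_neutral_right) (auto simp: delta0_def)
    then show ?thesis
      by (simp add: U_def G_def left_diff_distrib sum_subtractf sum_divide_distrib delta0_def)
  qed
  have U_cont: "continuous_on A U" for A
    unfolding U_def using M by (intro continuous_intros G_cont) auto

  \<comment> \<open>The condition says that |k| exceeds \<open>(n - 1) * N\<close>, which bounds the
    degree of the partial sum \<open>T\<close>. Hence \<open>T\<close> does not contribute to the
    coefficient at \<open>k\<close>, and only the geometric remainder is left to estimate.\<close>
  have decay: "\<bar>h k\<bar> \<le> r ^ n / G a" if k: "int n * int N < \<bar>k\<bar> + int N" for k n
  proof -
    define T where "T \<theta> = (\<Sum>i<n. U \<theta> ^ i) / M" for \<theta>
    have T_cont: "continuous_on A T" for A
      unfolding T_def using M by (intro continuous_intros U_cont) auto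
    have T_eq: "inverse (G \<theta>) - T \<theta> = U \<theta> ^ n * inverse (G \<theta>)" if "\<theta> \<in> {0..pi}" for \<theta>
    proof -
      have "(1 - U \<theta>) * (\<Sum>i<n. U \<theta> ^ i) = 1 - U \<theta> ^ n"
        by (rule one_diff_power_eq[symmetric])
      then have "G \<theta> * T \<theta> = 1 - U \<theta> ^ n" by (simp add: T_def U_def)
      then show ?thesis using G_pos[OF that] by (simp add: field_simps)
    qed
    have T_int: "integral {0..pi} (\<lambda>\<theta>. T \<theta> * cos (\<theta> * of_int k)) = 0"
    proof -
      have *: "integral {0..pi} (\<lambda>\<theta>. U \<theta> ^ i * cos (\<theta> * of_int k)) = 0" if "i < n" for i
      proof -
        have "int i * int N \<le> (int n - 1) * int N" using that by (intro mult_right_mono) auto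
        then have "int i * int N < \<bar>k\<bar>" using k by (simp add: algebra_simps)
        then show ?thesis
          using cosine_orthogonal_power[OF U_trig, of i] by (simp add: cosine_orthogonal_def)
      qed
      have "integral {0..pi} (\<lambda>\<theta>. T \<theta> * cos (\<theta> * of_int k))
          = integral {0..pi} (\<lambda>\<theta>. \<Sum>i<n. U \<theta> ^ i * cos (\<theta> * of_int k)) / M"
        by (simp add: T_def sum_distrib_right)
      also have "integral {0..pi} (\<lambda>\<theta>. \<Sum>i<n. U \<theta> ^ i * cos (\<theta> * of_int k)) = 0"
        by (subst Henstock_Kurzweil_Integration.integral_sum)
          (auto simp: * intro!: integrable_continuous_interval continuous_intros U_cont)
      finally show ?thesis by simp
    qed
    have "pi * h k = integral {0..pi} (\<lambda>\<theta>. inverse (G \<theta>) * cos (\<theta> * of_int k))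
        - integral {0..pi} (\<lambda>\<theta>. T \<theta> * cos (\<theta> * of_int k))"
      by (simp add: h_def T_int)
    also have "\<dots> = integral {0..pi} (\<lambda>\<theta>. (inverse (G \<theta>) - T \<theta>) * cos (\<theta> * of_int k))"
      unfolding left_diff_distrib
      by (rule Henstock_Kurzweil_Integration.integral_diff[symmetric])
        (intro integrable_continuous_interval continuous_intros iG_cont T_cont)+
    also have "norm \<dots> \<le> r ^ n / G a * (pi - 0)"
    proof (rule integral_bound)
      show "continuous_on {0..pi} (\<lambda>\<theta>. (inverse (G \<theta>) - T \<theta>) * cos (\<theta> * of_int k))"
        by (intro continuous_intros iG_cont T_cont)
      fix \<theta> assume \<theta>: "\<theta> \<in> {0..pi}"
      have "norm ((inverse (G \<theta>) - T \<theta>) * cos (\<theta> * of_int k))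
          = U \<theta> ^ n * inverse (G \<theta>) * \<bar>cos (\<theta> * of_int k)\<bar>"
        using U_bounds[OF \<theta>] G_pos[OF \<theta>] by (simp add: T_eq[OF \<theta>] abs_mult)
      also have "\<dots> \<le> r ^ n * inverse (G a) * 1"
        using U_bounds[OF \<theta>] G_pos[OF \<theta>] G_pos[OF a(1)] a(2)[OF \<theta>] r
        by (intro mult_mono power_mono le_imp_inverse_le) auto
      finally show "norm ((inverse (G \<theta>) - T \<theta>) * cos (\<theta> * of_int k)) \<le> r ^ n / G a"
        by (simp add: divide_inverse)
    qed simp
    finally have "pi * \<bar>h k\<bar> \<le> pi * (r ^ n / G a)" by (simp add: abs_mult mult.commute)
    then show ?thesis by (simp only: mult_le_cancel_left_pos[OF pi_gt_zero])
  qed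

  have "exponential_decay h"
  proof -
    \<comment> \<open>The bound \<open>r ^ n\<close> is available for \<open>n\<close> the quotient
      of |k| by \<open>N\<close>. The root spreads this over single steps of |k|; the remainder
      \<open>m < N\<close> costs at most a factor \<open>1 / r\<close>.\<close>
    define \<rho> where "\<rho> = root N r"
    have \<rho>: "0 < \<rho>" "\<rho> < 1" "\<rho> ^ N = r"
      using N r by (auto simp: \<rho>_def)
    have "norm (h k) \<le> 1 / G a / r * \<rho> ^ nat \<bar>k\<bar>" for k
    proof -
      define n where "n = nat \<bar>k\<bar> div N"
      define m where "m = nat \<bar>k\<bar> mod N"
      have km: "nat \<bar>k\<bar> = n * N + m" by (simp add: n_def m_def)
      then have "\<bar>k\<bar> = int n * int N + int m"
        by (metis abs_ge_zero int_nat_eq of_nat_add of_nat_mult)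
      then have "\<bar>h k\<bar> \<le> r ^ n / G a" using N by (intro decay) simp
      moreover have "r ^ n * r \<le> r ^ n * \<rho> ^ m"
      proof (rule mult_left_mono)
        have "\<rho> ^ N \<le> \<rho> ^ m" using \<rho> N by (intro power_decreasing) (auto simp: m_def intro: less_imp_le)
        then show "r \<le> \<rho> ^ m" by (simp add: \<rho>)
      qed (use r in simp)
      moreover have "r ^ n * \<rho> ^ m = \<rho> ^ nat \<bar>k\<bar>"
        unfolding km power_add by (simp add: \<rho>(3)[symmetric] power_mult[symmetric] mult.commute)
      ultimately have "\<bar>h k\<bar> \<le> r ^ n / G a" "r ^ n * r \<le> \<rho> ^ nat \<bar>k\<bar>" by simp_all
      then have "\<bar>h k\<bar> \<le> r ^ n / G a" "r ^ n \<le> \<rho> ^ nat \<bar>k\<bar> / r"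
        using r by (simp_all add: pos_le_divide_eq)
      moreover have "r ^ n / G a \<le> (\<rho> ^ nat \<bar>k\<bar> / r) / G a" if "r ^ n \<le> \<rho> ^ nat \<bar>k\<bar> / r"
        using that G_pos[OF a(1)] by (intro divide_right_mono) auto
      ultimately show ?thesis by (simp add: mult.commute)
    qed
    moreover have "0 < 1 / G a / r" using G_pos[OF a(1)] r by simp
    ultimately show ?thesis unfolding exponential_decay_def using \<rho> by blast
  qed
  moreover have "(\<Sum>j=-int N..int N. g j * h (k - j)) = delta0 k" for k
  proof -
    \<comment> \<open>Evenness of \<open>g\<close> removes the sine part of the addition formula, so
      convolution with \<open>g\<close> becomes multiplication by \<open>G\<close>, which cancels
      \<open>inverse (G \<theta>)\<close>.\<close>
    have sin_sum: "(\<Sum>j=-int N..int N. g j * sin (\<theta> * of_int j)) = 0" for \<theta>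
    proof -
      have "(\<Sum>j=-int N..int N. g j * sin (\<theta> * of_int j)) = (\<Sum>j=-int N..int N. - (g j * sin (\<theta> * of_int j)))"
        by (rule sum.reindex_bij_witness[of _ uminus uminus]) (auto simp: even)
      then show ?thesis by (simp add: sum_negf)
    qed
    have cos_sum: "(\<Sum>j=-int N..int N. g j * cos (\<theta> * of_int (k - j))) = G \<theta> * cos (\<theta> * of_int k)" for \<theta>
    proof -
      have "(\<Sum>j=-int N..int N. g j * cos (\<theta> * of_int (k - j))) =
          (\<Sum>j=-int N..int N. g j * cos (\<theta> * of_int j)) * cos (\<theta> * of_int k)
          + (\<Sum>j=-int N..int N. g j * sin (\<theta> * of_int j)) * sin (\<theta> * of_int k)"
        unfolding sum_distrib_right sum.distrib[symmetric]
        by (intro sum.cong refl) (simp add: right_diff_distrib cos_diff, simp add: algebra_simps)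
      then show ?thesis unfolding sin_sum G_def by simp
    qed
    have "pi * (\<Sum>j=-int N..int N. g j * h (k - j)) =
        (\<Sum>j=-int N..int N. integral {0..pi} (\<lambda>\<theta>. inverse (G \<theta>) * (g j * cos (\<theta> * of_int (k - j)))))"
      unfolding sum_distrib_left
    proof (rule sum.cong[OF refl])
      fix j
      have "integral {0..pi} (\<lambda>\<theta>. inverse (G \<theta>) * (g j * cos (\<theta> * of_int (k - j))))
        = integral {0..pi} (\<lambda>\<theta>. g j * (inverse (G \<theta>) * cos (\<theta> * of_int (k - j))))"
        by (simp only: mult_ac)
      then show "pi * (g j * h (k - j)) = integral {0..pi} (\<lambda>\<theta>. inverse (G \<theta>) * (g j * cos (\<theta> * of_int (k - j))))"
        by (simp add: h_def)
    qed
    also have "\<dots> = integral {0..pi} (\<lambda>\<theta>. \<Sum>j=-int N..int N. inverse (G \<theta>) * (g j * cos (\<theta> * of_int (k - j))))"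
      by (rule Henstock_Kurzweil_Integration.integral_sum[symmetric])
        (auto intro!: integrable_continuous_interval continuous_intros iG_cont)
    also have "\<dots> = integral {0..pi} (\<lambda>\<theta>. cos (\<theta> * of_int k))"
    proof (rule Henstock_Kurzweil_Integration.integral_cong)
      fix \<theta> assume "\<theta> \<in> {0..pi}"
      then show "(\<Sum>j=-int N..int N. inverse (G \<theta>) * (g j * cos (\<theta> * of_int (k - j)))) = cos (\<theta> * of_int k)"
        unfolding sum_distrib_left[symmetric] cos_sum using G_pos[of \<theta>] by simp
    qed
    also have "\<dots> = pi * delta0 k" by (simp add: integral_cos_int delta0_def)
    finally show ?thesis by simp
  qed
  ultimately show ?thesis by blast
qed

section \<open>Summability and uniqueness of the convolution inverse\<close>

lemma summable_on_power_abs_int: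
  fixes r :: real
  assumes "0 < r" "r < 1"
  shows "(\<lambda>k :: int. r ^ nat \<bar>k\<bar>) summable_on UNIV"
proof -
  have r: "(\<lambda>n. r ^ n) summable_on UNIV"
    using assms by (intro norm_summable_imp_summable_on) (simp add: summable_geometric)
  have "(\<lambda>k. r ^ nat \<bar>k\<bar>) summable_on (int ` UNIV)"
    by (subst summable_on_reindex) (use r in \<open>auto simp: o_def\<close>)
  moreover have "(\<lambda>k. r ^ nat \<bar>k\<bar>) summable_on ((\<lambda>n. - int n) ` UNIV)"
    by (subst summable_on_reindex) (use r in \<open>auto simp: o_def inj_on_def\<close>)
  ultimately have "(\<lambda>k. r ^ nat \<bar>k\<bar>) summable_on (int ` UNIV \<union> (\<lambda>n. - int n) ` UNIV)"
    by (rule summable_on_union)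
  also have "int ` UNIV \<union> (\<lambda>n. - int n) ` UNIV = UNIV"
  proof (intro equalityI subset_UNIV subsetI)
    fix k :: int
    show "k \<in> range int \<union> range (\<lambda>n. - int n)" by (cases k rule: int_cases2) auto
  qed
  finally show ?thesis .
qed

lemma exponential_decay_imp_summable:
  assumes "exponential_decay s"
  shows "(\<lambda>k. norm (s k)) summable_on UNIV"
proof -
  obtain C r where C: "0 < C" "0 < r" "r < 1" "\<And>k. norm (s k) \<le> C * r ^ nat \<bar>k\<bar>"
    using assms unfolding exponential_decay_def by auto
  have "(\<lambda>k. C * r ^ nat \<bar>k\<bar>) summable_on UNIV"
    by (intro summable_on_cmult_right summable_on_power_abs_int C)
  then show ?thesis by (rule summable_on_comparison_test) (use C in auto)
qed

lemma exponential_decay_imp_ell2: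
  assumes "exponential_decay s"
  shows "s \<in> ell2"
proof -
  obtain C r where C: "0 < C" "0 < r" "r < 1" "\<And>k. norm (s k) \<le> C * r ^ nat \<bar>k\<bar>"
    using assms unfolding exponential_decay_def by auto
  have bound: "norm (s k) \<le> C" for k
  proof -
    have "C * r ^ nat \<bar>k\<bar> \<le> C * 1" using C by (intro mult_left_mono power_le_one) auto
    then show ?thesis using C(4)[of k] by simp
  qed
  have "(\<lambda>k. C * norm (s k)) summable_on UNIV"
    by (intro summable_on_cmult_right exponential_decay_imp_summable assms)
  then have "(\<lambda>k. (norm (s k))\<^sup>2) summable_on UNIV"
    by (rule summable_on_comparison_test) (auto simp: power2_eq_square intro: mult_right_mono bound)
  then show ?thesis by (simp add: ell2_def)
qed

text \<open>Boundedness makes products with an absolutely summable sequence summable, as the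
  uniqueness argument requires.\<close>

lemma ell2_imp_bounded:
  assumes "s \<in> ell2"
  obtains B where "\<And>k. norm (s k) \<le> B"
proof
  fix k :: int
  have sm: "(\<lambda>k. (norm (s k))\<^sup>2) summable_on UNIV" using assms by (simp add: ell2_def)
  have "(\<Sum>k\<in>{k}. (norm (s k))\<^sup>2) \<le> (\<Sum>\<^sub>\<infinity>k. (norm (s k))\<^sup>2)"
    by (intro finite_sum_le_infsum sm) auto
  then show "norm (s k) \<le> sqrt (\<Sum>\<^sub>\<infinity>k. (norm (s k))\<^sup>2)"
    by (intro real_le_rsqrt) simp
qed

lemma infsum_of_finite_sum:
  fixes f :: "'i \<Rightarrow> 'b \<Rightarrow> 'c::{topological_comm_monoid_add, t2_space}"
  assumes "finite I" "\<And>i. i \<in> I \<Longrightarrow> f i summable_on A"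
  shows "(\<Sum>\<^sub>\<infinity>x\<in>A. \<Sum>i\<in>I. f i x) = (\<Sum>i\<in>I. infsum (f i) A)"
proof -
  have "((\<lambda>x. \<Sum>i\<in>I. f i x) has_sum (\<Sum>i\<in>I. infsum (f i) A)) A"
    using assms by (induction I rule: finite_induct) (auto intro: has_sum_add)
  then show ?thesis by (rule infsumI)
qed

lemma convolution_int_finite_support:
  assumes "\<And>j. int N < \<bar>j\<bar> \<Longrightarrow> g j = 0"
  shows "(a \<star> g) k = (\<Sum>j=-int N..int N. a (k - j) * g j)"
  unfolding convolution_int_def
  by (rule infsum_finite_support) (use assms in auto)

text \<open>The computation is s = s * (h * g) = (s * g) * h = h with * read as convolution. As
  \<open>g\<close> has finite support, the rearrangement only exchanges a finite sum with an
  infinite one.\<close>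

lemma convolution_inverse_unique:
  fixes s h g :: "int \<Rightarrow> 'a::{real_normed_field,banach}"
  assumes g: "\<And>j. int N < \<bar>j\<bar> \<Longrightarrow> g j = 0"
    and s: "s \<in> ell2" "s \<star> g = delta0"
    and h: "exponential_decay h" "h \<star> g = delta0"
  shows "s = h"
proof
  fix k
  let ?I = "{-int N..int N}"
  obtain B where B: "\<And>k. norm (s k) \<le> B" using ell2_imp_bounded[OF s(1)] by blast
  have conv: "(a \<star> g) l = (\<Sum>j\<in>?I. a (l - j) * g j)" for a l
    by (rule convolution_int_finite_support) (rule g)
  have summable: "(\<lambda>l. s (a - l) * h (l - j)) summable_on UNIV" for a j
  proof (rule abs_summable_summable, rule summable_on_comparison_test)
    have "(\<lambda>l. norm (h (l - j))) summable_on UNIV"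
      using exponential_decay_imp_summable[OF h(1)]
      by (subst summable_on_reindex_bij_witness[of _ "\<lambda>l. l + j" "\<lambda>l. l - j" UNIV "\<lambda>l. norm (h l)"]) auto
    then show "(\<lambda>l. B * norm (h (l - j))) summable_on UNIV" by (rule summable_on_cmult_right)
  qed (auto simp: norm_mult intro: mult_right_mono B)
  have "s k = (\<Sum>\<^sub>\<infinity>l. s (k - l) * delta0 l)"
    by (subst infsum_finite_support[of "{0}"]) (auto simp: delta0_def)
  also have "\<dots> = (\<Sum>\<^sub>\<infinity>l. \<Sum>j\<in>?I. g j * (s (k - l) * h (l - j)))"
    unfolding h(2)[symmetric] unfolding conv
    by (simp add: sum_distrib_left mult_ac)
  also have "\<dots> = (\<Sum>j\<in>?I. \<Sum>\<^sub>\<infinity>l. g j * (s (k - l) * h (l - j)))"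
    by (intro infsum_of_finite_sum summable_on_cmult_right summable) auto
  \<comment> \<open>Translating the index by \<open>j\<close> moves the shift from \<open>h\<close>
    to \<open>s\<close>, so that \<open>g\<close> can be regrouped with \<open>s\<close>.\<close>
  also have "\<dots> = (\<Sum>j\<in>?I. \<Sum>\<^sub>\<infinity>l. g j * (s (k - l - j) * h l))"
  proof (rule sum.cong[OF refl])
    fix j
    show "(\<Sum>\<^sub>\<infinity>l. g j * (s (k - l) * h (l - j))) = (\<Sum>\<^sub>\<infinity>l. g j * (s (k - l - j) * h l))"
      by (rule infsum_reindex_bij_witness[of _ "\<lambda>l. l + j" "\<lambda>l. l - j"]) (auto simp: algebra_simps)
  qed
  also have "\<dots> = (\<Sum>\<^sub>\<infinity>l. \<Sum>j\<in>?I. g j * (s (k - l - j) * h l))"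
  proof (intro infsum_of_finite_sum[symmetric] summable_on_cmult_right)
    fix j
    show "(\<lambda>l. s (k - l - j) * h l) summable_on UNIV"
      using summable[of "k - j" 0] by (simp add: algebra_simps)
  qed auto
  also have "\<dots> = (\<Sum>\<^sub>\<infinity>l. h l * delta0 (k - l))"
    unfolding s(2)[symmetric] unfolding conv
    by (simp add: sum_distrib_left mult_ac)
  also have "\<dots> = h k"
    by (subst infsum_finite_support[of "{k}"]) (auto simp: delta0_def)
  finally show "s k = h k" .
qed

section \<open>Transfer to general scalars and conclusion\<close>

text \<open>The sums have finite support, so \<open>of_real\<close> passes through them.\<close>

lemma downsample_autocorrelation_of_real:
  assumes p: "0 < p" and q: "1 \<le> q"
  shows "downsample q (sampled_bspline p q \<star> sampled_bspline p q) =
    (\<lambda>j. of_real (sampled_autocorrelation p q j) :: 'a::{real_normed_field,banach})"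
proof
  fix j :: int
  let ?b = "\<lambda>k. bspline p (of_int k / of_nat q)"
  define L where "L = int (q * (p + 1))"
  have zero: "?b (int q * j - l) * ?b l = 0" if "l \<notin> {-L..L}" for l
  proof (rule sampled_convolution_summand_eq_0[OF p], rule disjI1)
    have "L \<le> \<bar>l\<bar>" using that by auto
    then have "real_of_int L \<le> \<bar>of_int l\<bar>" by linarith
    then show "\<not> \<bar>of_int l / real q\<bar> < real p + 1"
      using q by (simp add: L_def field_simps)
  qed
  have "downsample q (sampled_bspline p q \<star> sampled_bspline p q) j =
      (\<Sum>\<^sub>\<infinity>l. of_real (?b (int q * j - l) * ?b l) :: 'a)"
    unfolding downsample_def convolution_int_def sampled_bspline_def by simp
  also have "\<dots> = (\<Sum>l=-L..L. of_real (?b (int q * j - l) * ?b l))"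
    by (rule infsum_finite_support) (use zero in \<open>auto simp del: mult_eq_0_iff\<close>)
  also have "\<dots> = of_real (\<Sum>l=-L..L. ?b (int q * j - l) * ?b l)" by simp
  also have "(\<Sum>l=-L..L. ?b (int q * j - l) * ?b l) = (\<Sum>\<^sub>\<infinity>l. ?b (int q * j - l) * ?b l)"
    by (rule infsum_finite_support[symmetric]) (use zero in auto)
  also have "\<dots> = sampled_autocorrelation p q j"
    unfolding sampled_autocorrelation_def downsample_def convolution_int_def sampled_bspline_def by simp
  finally show "downsample q (sampled_bspline p q \<star> sampled_bspline p q) j =
      (of_real (sampled_autocorrelation p q j) :: 'a)" .
qed

theorem theorem6:
  fixes p q :: nat
  assumes "p > 0" and "q \<ge> 1"
  shows "(\<exists>!s :: int \<Rightarrow> 'a::{real_normed_field,banach}.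
            s \<in> ell2 \<and>
            s \<star> downsample q (sampled_bspline p q \<star> sampled_bspline p q) = delta0) \<and>
         (\<forall>s :: int \<Rightarrow> 'a.
            s \<in> ell2 \<and>
            s \<star> downsample q (sampled_bspline p q \<star> sampled_bspline p q) = delta0
            \<longrightarrow> exponential_decay s)"
proof -
  let ?g = "\<lambda>j. of_real (sampled_autocorrelation p q j) :: 'a"
  have g: "?g j = 0" if "int (2 * p + 2) < \<bar>j\<bar>" for j
    using sampled_autocorrelation_eq_0[OF assms that] by simp
  obtain h :: "int \<Rightarrow> real" where h: "exponential_decay h"
    "\<And>k. (\<Sum>j=-int (2 * p + 2)..int (2 * p + 2). sampled_autocorrelation p q j * h (k - j)) = delta0 k"
    using exponentially_decaying_convolution_inverse[of "2 * p + 2" "sampled_autocorrelation p q"]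
      sampled_autocorrelation_minus[OF assms(1)] sampled_autocorrelation_symbol_pos[OF assms]
    by auto
  define s where "s k = (of_real (h k) :: 'a)" for k
  have s_decay: "exponential_decay s"
    using h(1) by (simp add: exponential_decay_def s_def)
  have s_inverse: "s \<star> ?g = delta0"
  proof
    fix k
    have "(s \<star> ?g) k = (\<Sum>j=-int (2 * p + 2)..int (2 * p + 2). s (k - j) * ?g j)"
      by (rule convolution_int_finite_support[OF g])
    also have "\<dots> = of_real (\<Sum>j=-int (2 * p + 2)..int (2 * p + 2). sampled_autocorrelation p q j * h (k - j))"
      unfolding of_real_sum of_real_mult s_def by (simp only: mult.commute)
    also have "\<dots> = delta0 k" unfolding h(2) by (simp add: delta0_def)
    finally show "(s \<star> ?g) k = delta0 k" .
  qed
  \<comment> \<open>Every square-summable solution is the embedded real inverse \<open>s\<close>, so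
    uniqueness and the decay of all solutions follow together.\<close>
  have unique: "t = s" if "t \<in> ell2 \<and> t \<star> ?g = delta0" for t
    using convolution_inverse_unique[OF g _ _ s_decay s_inverse] that by blast
  show ?thesis
    unfolding downsample_autocorrelation_of_real[OF assms]
    using unique s_decay s_inverse exponential_decay_imp_ell2[OF s_decay] by metis
qed

end
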